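(* Let $n \in \mathbb{N}$, $A \in \mathbb{R}^{n \times n}$, and consider the class of differential equations $$\dot x(t) = A x(t) + P u(t), \qquad P = I,$$ with $I \in \mathbb{R}^{n\times n}$ the identity matrix and continuous inputs $u$. Then the following three statements are equivalent: (i) the equation $\dot x(t) = A x(t) + P u(t)$ with $P=I$ is locally active; (ii) $A$ is not dissipative, i.e. there exists $x \in \mathbb{R}^n$ with $\langle Ax, x\rangle > 0$; (iii) there exists a positive eigenvalue of $A + A^\top$.
   Context: $\langle\cdot,\cdot\rangle$ is the standard inner product on $\mathbb{R}^n$. Local activity: for $A \in \mathbb{R}^{n\times n}$ and a projection $P \in \mathbb{R}^{n\times n}$ (i.e. $P^2=P$), the equation $\dot x(t) = A x(t) + P u(t)$ is called locally active if there exist $T>0$ and $u \in C([0,T],\mathbb{R}^n)$ such that the solution $x \in C([0,T],\mathbb{R}^n)$ of the initial value problem $\dot x(t) = Ax(t)+Pu(t)$, $x(0)=0$, satisfies $$W_T(u) := \int_0^T \langle x(t), P u(t)\rangle\, dt < 0.$$ *)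

theory Defs
  imports "HOL-Analysis.Analysis"
begin

definition is_projection :: "real^'n^'n \<Rightarrow> bool" where
  "is_projection P \<longleftrightarrow> P ** P = P"

text \<open>\<open>x\<close> is the solution on \<open>[0, T]\<close> of \<open>x' = A x + P u\<close>, \<open>x 0 = 0\<close>. At the endpoints the
  derivative is one-sided. Existence of the derivative makes \<open>x\<close> continuous on \<open>[0, T]\<close>, and
  its values outside this interval are irrelevant.\<close>

definition solves_ivp ::
  "real^'n^'n \<Rightarrow> real^'n^'n \<Rightarrow> real \<Rightarrow> (real \<Rightarrow> real^'n) \<Rightarrow> (real \<Rightarrow> real^'n) \<Rightarrow> bool" where
  "solves_ivp A P T u x \<longleftrightarrow>
     x 0 = 0 \<and>
     (\<forall>t\<in>{0..T}. (x has_vector_derivative (A *v x t + P *v u t)) (at t within {0..T}))"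

text \<open>The solution of the linear initial value problem is unique on \<open>[0, T]\<close>, so it can be
  quantified existentially.\<close>

definition locally_active :: "real^'n^'n \<Rightarrow> real^'n^'n \<Rightarrow> bool" where
  "locally_active A P \<longleftrightarrow>
     is_projection P \<and>
     (\<exists>T>0. \<exists>u x. continuous_on {0..T} u \<and> solves_ivp A P T u x \<and>
        integral {0..T} (\<lambda>t. x t \<bullet> (P *v u t)) < 0)"

definition dissipative :: "real^'n^'n \<Rightarrow> bool" where
  "dissipative A \<longleftrightarrow> (\<forall>x. (A *v x) \<bullet> x \<le> 0)"

definition eigenvalue :: "real^'n^'n \<Rightarrow> real \<Rightarrow> bool" where
  "eigenvalue M k \<longleftrightarrow> (\<exists>v. v \<noteq> 0 \<and> M *v v = k *\<^sub>R v)"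

end

theory Submission
  imports Defs
begin

text \<open>
  Along a solution of \<open>x' = A x + u\<close> the energy \<open>\<bar>x\<bar>\<^sup>2 / 2\<close> grows at the rate
  \<open>(A x) \<bullet> x + x \<bullet> u\<close>. As \<open>x 0 = 0\<close>, integration gives the energy balance
  \<open>W = \<bar>x T\<bar>\<^sup>2 / 2 - \<integral> (A x) \<bullet> x\<close>, where \<open>W\<close> is the supplied work, the integral of \<open>x \<bullet> u\<close>.
  For dissipative \<open>A\<close> both contributions are nonnegative, so no input makes \<open>W\<close> negative
  (\<open>dissipative_imp_work_nonneg\<close>).

  Conversely, with the identity as input matrix every \<open>C\<^sup>1\<close> curve starting at \<open>0\<close> is a solution,
  namely for the input \<open>u = x' - A x\<close>. If \<open>(A v) \<bullet> v > 0\<close>, the loop \<open>x t = (t - t\<^sup>2) v\<close> on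
  \<open>[0, 1]\<close> returns to zero energy, so only the negative term \<open>- \<integral> (A x) \<bullet> x\<close> is left
  (\<open>positive_direction_imp_locally_active\<close>).

  Finally, \<open>2 (A x) \<bullet> x\<close> is the quadratic form of the symmetric matrix \<open>A + A\<^sup>T\<close>. A symmetric
  matrix attains the maximum of its quadratic form over the unit sphere at an eigenvector, with
  the maximum as eigenvalue (\<open>symmetric_max_eigenvalue\<close>). Hence the form takes a positive value
  if and only if there is a positive eigenvalue.
\<close>

lemma energy_balance:
  fixes A :: "real^'n^'n"
  assumes T: "0 \<le> T" and sol: "solves_ivp A (mat 1) T u x"
  shows "((\<lambda>t. x t \<bullet> u t + (A *v x t) \<bullet> x t) has_integral (x T \<bullet> x T) / 2) {0..T}"
proof -
  have "((\<lambda>t. x t \<bullet> x t / 2) has_vector_derivative x t \<bullet> u t + (A *v x t) \<bullet> x t)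
          (at t within {0..T})" if "t \<in> {0..T}" for t
  proof -
    have "(x has_vector_derivative A *v x t + u t) (at t within {0..T})"
      using sol that by (simp add: solves_ivp_def)
    then have x: "(x has_derivative (\<lambda>h. h *\<^sub>R (A *v x t + u t))) (at t within {0..T})"
      by (simp add: has_vector_derivative_def)
    show ?thesis
      unfolding has_vector_derivative_def
      by (rule derivative_eq_intros x refl)+
        (simp_all add: fun_eq_iff inner_commute inner_add_right algebra_simps)
  qed
  from fundamental_theorem_of_calculus[OF T this] sol show ?thesis
    by (simp add: solves_ivp_def)
qed

lemma dissipative_imp_work_nonneg:
  fixes A :: "real^'n^'n"
  assumes "dissipative A" and T: "0 \<le> T" and u: "continuous_on {0..T} u"
    and sol: "solves_ivp A (mat 1) T u x"
  shows "0 \<le> integral {0..T} (\<lambda>t. x t \<bullet> u t)"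
proof -
  have x: "continuous_on {0..T} x"
    using sol unfolding solves_ivp_def
    by (auto intro: has_vector_derivative_continuous simp: continuous_on_eq_continuous_within)
  have work: "(\<lambda>t. x t \<bullet> u t) integrable_on {0..T}"
    by (intro integrable_continuous_real continuous_intros x u)
  have diss: "(\<lambda>t. (A *v x t) \<bullet> x t) integrable_on {0..T}"
    by (intro integrable_continuous_real continuous_intros x
        matrix_vector_mult_linear_continuous_on[THEN continuous_on_compose2[OF _ x subset_UNIV]])
  have "integral {0..T} (\<lambda>t. (A *v x t) \<bullet> x t) \<le> integral {0..T} (\<lambda>t. 0)"
    using \<open>dissipative A\<close> by (intro integral_le diss) (auto simp: dissipative_def)
  moreover have "integral {0..T} (\<lambda>t. x t \<bullet> u t) + integral {0..T} (\<lambda>t. (A *v x t) \<bullet> x t)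
      = x T \<bullet> x T / 2"
    using integral_unique[OF energy_balance[OF T sol]] integral_add[OF work diss] by simp
  moreover have "0 \<le> x T \<bullet> x T"
    by simp
  ultimately show ?thesis
    by (simp only: integral_0)
qed

text \<open>
  A loop through the origin along \<open>v\<close> costs no net energy, so the work is minus the energy
  released along \<open>v\<close>. Here \<open>\<integral> (t - t\<^sup>2)\<^sup>2 = 1/30\<close> on \<open>[0, 1]\<close>, and so the work is
  \<open>- ((A v) \<bullet> v) / 30\<close>.
\<close>

lemma positive_direction_imp_locally_active:
  fixes A :: "real^'n^'n"
  assumes pos: "(A *v v) \<bullet> v > 0"
  shows "locally_active A (mat 1)"
proof -
  define x where "x t = (t - t\<^sup>2) *\<^sub>R v" for t :: real
  define u where "u t = (1 - 2 * t) *\<^sub>R v - (t - t\<^sup>2) *\<^sub>R (A *v v)" for t :: real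
  have "(x has_vector_derivative A *v x t + u t) (at t within {0..1})" for t
    unfolding x_def u_def has_vector_derivative_def
    by (auto intro!: derivative_eq_intros simp: fun_eq_iff algebra_simps
        matrix_vector_mult_scaleR)
  then have sol: "solves_ivp A (mat 1) 1 u x"
    by (simp add: solves_ivp_def x_def)
  have u: "continuous_on {0..1} u"
    unfolding u_def by (intro continuous_intros)
  have diss: "((\<lambda>t. (A *v x t) \<bullet> x t) has_integral ((A *v v) \<bullet> v) / 30) {0..1}"
  proof -
    have "((\<lambda>t. (t^3/3 - t^4/2 + t^5/5) * ((A *v v) \<bullet> v)) has_vector_derivative
            (A *v x t) \<bullet> x t) (at t within {0..1})" for t :: real
      unfolding x_def has_real_derivative_iff_has_vector_derivative[symmetric]
      by (auto intro!: derivative_eq_intros simp: matrix_vector_mult_scaleR)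
        (simp add: power2_eq_square power3_eq_cube power4_eq_xxxx algebra_simps)
    from fundamental_theorem_of_calculus[OF zero_le_one this] show ?thesis
      by simp
  qed
  have "((\<lambda>t. x t \<bullet> u t) has_integral - (((A *v v) \<bullet> v) / 30)) {0..1}"
    using has_integral_diff[OF energy_balance[OF _ sol] diss] by (simp add: x_def)
  then have "integral {0..1} (\<lambda>t. x t \<bullet> (mat 1 *v u t)) < 0"
    using pos by (simp add: integral_unique)
  moreover have "is_projection (mat 1 :: real^'n^'n)"
    by (simp add: is_projection_def)
  ultimately show ?thesis
    unfolding locally_active_def using sol u zero_less_one by blast
qed

lemma inner_add_transpose:
  fixes A :: "real^'n^'n"
  shows "((A + transpose A) *v x) \<bullet> x = 2 * ((A *v x) \<bullet> x)"
  by (simp add: matrix_vector_mult_add_rdistrib inner_add_left dot_lmul_matrix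
      inner_commute[of x])

text \<open>
  The vector \<open>v\<close> maximizes the form. As \<open>B\<close> is symmetric, perturbing \<open>v\<close> to \<open>v + t w\<close> changes the
  form by \<open>2 t ((B v) \<bullet> w) + t\<^sup>2 ((B w) \<bullet> w)\<close>. At a maximum the linear coefficient vanishes,
  and for \<open>w = B v\<close> it is \<open>2 \<bar>B v\<bar>\<^sup>2\<close>.
\<close>

lemma symmetric_nonpos_form_zero:
  fixes B :: "real^'n^'n"
  assumes sym: "transpose B = B" and nonpos: "\<And>y. (B *v y) \<bullet> y \<le> 0"
    and zero: "(B *v v) \<bullet> v = 0"
  shows "B *v v = 0"
proof -
  define w where "w = B *v v"
  define a where "a = w \<bullet> w"
  define b where "b = (B *v w) \<bullet> w"
  have cross: "(B *v w) \<bullet> v = a"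
    by (metis a_def w_def sym dot_lmul_matrix inner_commute transpose_matrix_vector)
  have ineq: "2 * t * a + t\<^sup>2 * b \<le> 0" for t
    using nonpos[of "v + t *\<^sub>R w"] zero cross
    by (simp add: matrix_vector_right_distrib matrix_vector_mult_scaleR inner_add_left
        inner_add_right a_def b_def power2_eq_square algebra_simps flip: w_def)
  have b: "b \<le> 0"
    using nonpos by (simp add: b_def)
  \<comment> \<open>The factor \<open>a\<close> in the step makes both terms multiples of \<open>a\<^sup>2\<close>; the divisor keeps the step
    short enough for the linear term to dominate.\<close>
  have "2 * (a / (1 - b)) * a + (a / (1 - b))\<^sup>2 * b = a\<^sup>2 * (2 - b) / (1 - b)\<^sup>2"
    using b by (simp add: divide_simps) (simp add: power2_eq_square algebra_simps)
  with ineq[of "a / (1 - b)"] have "a\<^sup>2 * (2 - b) / (1 - b)\<^sup>2 \<le> 0"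
    by simp
  with b have "a = 0"
    by (auto simp: divide_le_0_iff mult_le_0_iff)
  then show ?thesis
    by (simp add: a_def w_def)
qed

text \<open>
  The maximum \<open>k\<close> of the form over the compact unit sphere exists, and by homogeneity the form of
  \<open>S - k I\<close> is nonpositive everywhere and vanishes at the maximizer.
\<close>

lemma symmetric_max_eigenvalue:
  fixes S :: "real^'n^'n"
  assumes sym: "transpose S = S"
  obtains k where "eigenvalue S k" "\<And>y. (S *v y) \<bullet> y \<le> k * (y \<bullet> y)"
proof -
  let ?q = "\<lambda>y. (S *v y) \<bullet> y"
  have "continuous_on (sphere 0 1) ?q"
    by (intro continuous_intros matrix_vector_mult_linear_continuous_on)
  moreover have "axis undefined 1 \<in> sphere (0 :: real^'n) 1"
    by (simp add: norm_axis_1)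
  ultimately obtain v where v: "norm v = 1" and max: "\<And>z. norm z = 1 \<Longrightarrow> ?q z \<le> ?q v"
    using continuous_attains_sup[of "sphere 0 1" ?q] by (auto simp: dist_norm)
  have bound: "?q y \<le> ?q v * (y \<bullet> y)" for y
  proof (cases "y = 0")
    case False
    have "?q (y /\<^sub>R norm y) = ?q y / (y \<bullet> y)"
      by (simp add: matrix_vector_mult_scaleR divide_inverse dot_square_norm power2_eq_square)
    moreover have "?q (y /\<^sub>R norm y) \<le> ?q v"
      using False by (intro max) simp
    ultimately show ?thesis
      using False by (simp add: pos_divide_le_eq)
  qed simp
  define B where "B = S - mat (?q v)"
  have B: "B *v y = S *v y - ?q v *\<^sub>R y" for y
  proof -
    have "mat (?q v) *v y = ?q v *\<^sub>R y"
      by (simp add: vec_eq_iff mat_def matrix_vector_mult_def if_distrib[of "\<lambda>a. a * _"]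
          cong: if_cong)
    then show ?thesis
      by (simp add: B_def matrix_vector_mult_diff_rdistrib)
  qed
  have "B *v v = 0"
  proof (rule symmetric_nonpos_form_zero)
    show "transpose B = B"
      using sym by (auto simp: B_def transpose_def mat_def vec_eq_iff)
    show "(B *v y) \<bullet> y \<le> 0" for y
      using bound[of y] by (simp add: B inner_diff_left)
    show "(B *v v) \<bullet> v = 0"
      using v by (simp add: B inner_diff_left dot_square_norm)
  qed
  then have "eigenvalue S (?q v)"
    using v by (auto simp: eigenvalue_def B intro!: exI[of _ v])
  with bound show ?thesis
    using that by blast
qed

theorem theorem2:
  fixes A :: "real^'n^'n"
  shows "(locally_active A (mat 1) \<longleftrightarrow> \<not> dissipative A) \<and>
         (\<not> dissipative A \<longleftrightarrow> (\<exists>k>0. eigenvalue (A + transpose A) k))"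
proof (intro conjI iffI)
  assume "locally_active A (mat 1)"
  then obtain T u x where "0 < T" "continuous_on {0..T} u" "solves_ivp A (mat 1) T u x"
    "integral {0..T} (\<lambda>t. x t \<bullet> u t) < 0"
    by (auto simp: locally_active_def)
  then show "\<not> dissipative A"
    using dissipative_imp_work_nonneg[of A T u x] by fastforce
next
  assume "\<not> dissipative A"
  then show "locally_active A (mat 1)"
    by (auto simp: dissipative_def not_le intro: positive_direction_imp_locally_active)
next
  assume "\<not> dissipative A"
  then obtain y where y: "(A *v y) \<bullet> y > 0"
    by (auto simp: dissipative_def not_le)
  have "transpose (A + transpose A) = A + transpose A"
    by (simp add: transpose_def vec_eq_iff)
  then obtain k where k: "eigenvalue (A + transpose A) k"
    "\<And>y. ((A + transpose A) *v y) \<bullet> y \<le> k * (y \<bullet> y)"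
    using symmetric_max_eigenvalue by blast
  have "0 < k * (y \<bullet> y)"
    using y k(2)[of y] by (simp add: inner_add_transpose)
  then have "0 < k"
    by (metis inner_ge_zero mult_nonpos_nonneg not_less)
  with k(1) show "\<exists>k>0. eigenvalue (A + transpose A) k"
    by blast
next
  assume "\<exists>k>0. eigenvalue (A + transpose A) k"
  then obtain k v where "k > 0" "v \<noteq> 0" "(A + transpose A) *v v = k *\<^sub>R v"
    by (auto simp: eigenvalue_def)
  then have "0 < (A *v v) \<bullet> v"
    using inner_add_transpose[of A v] mult_pos_pos[of k "v \<bullet> v"] by simp
  then show "\<not> dissipative A"
    by (auto simp: dissipative_def not_le)
qed

end
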